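(* Let $y>0$ and either $\mu>0$, $x\ge 0$, or $\mu=0$, $x>0$. The function $H_{\mu}(x,y)=Q_{\mu+1}(x,y)/Q_{\mu}(x,y)$ is increasing as a function of $y$ and decreasing as a function of $x$ and of $\mu$. In addition, $$H_{\mu}(x,y)>\max\{1,c_{\mu}(x,y)\}.$$
   Context: For real $\mu$, $x>0$, $y\ge 0$, $Q_{\mu}(x,y)=x^{\frac12(1-\mu)}\int_y^{\infty} t^{\frac12(\mu-1)}e^{-t-x}I_{\mu-1}(2\sqrt{xt})\,dt$ ($I_\nu$ the modified Bessel function of the first kind); for $\mu>0$, $Q_\mu(0,y)=\Gamma(\mu,y)/\Gamma(\mu)$ by continuity. For $x>0$, $y>0$: $c_{\mu}(x,y)=\sqrt{y/x}\,I_{\mu}(2\sqrt{xy})/I_{\mu-1}(2\sqrt{xy})$; for $\mu>0$, $c_\mu(0,y)=y/\mu$. *)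

theory Defs
  imports "HOL-Analysis.Analysis"
begin

text \<open>Modified Bessel function of the first kind of real order nu, for z > 0, via its
  power series; rGamma (the reciprocal Gamma function, zero at the poles) makes the
  series correct also for negative integer orders.\<close>
definition besselI :: "real \<Rightarrow> real \<Rightarrow> real" where
  "besselI nu z = (\<Sum>k. (z / 2) powr (2 * real k + nu) * rGamma (real k + nu + 1) / fact k)"

text \<open>Generalized Marcum Q-function; for x = 0 the continuous extension
  Gamma(mu,y)/Gamma(mu) (upper incomplete gamma, normalized).\<close>
definition marcumQ :: "real \<Rightarrow> real \<Rightarrow> real \<Rightarrow> real" where
  "marcumQ mu x y =
     (if x = 0 then integral {y..} (\<lambda>t. t powr (mu - 1) * exp (- t)) / Gamma mu
      else x powr ((1 - mu) / 2) *
        integral {y..} (\<lambda>t. t powr ((mu - 1) / 2) * exp (- t - x) * besselI (mu - 1) (2 * sqrt (x * t))))"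

definition cfun :: "real \<Rightarrow> real \<Rightarrow> real \<Rightarrow> real" where
  "cfun mu x y =
     (if x = 0 then y / mu
      else sqrt (y / x) * besselI mu (2 * sqrt (x * y)) / besselI (mu - 1) (2 * sqrt (x * y)))"

definition Hfun :: "real \<Rightarrow> real \<Rightarrow> real \<Rightarrow> real" where
  "Hfun mu x y = marcumQ (mu + 1) x y / marcumQ mu x y"

definition admissible :: "real \<Rightarrow> real \<Rightarrow> bool" where
  "admissible mu x \<longleftrightarrow> (mu > 0 \<and> x \<ge> 0) \<or> (mu = 0 \<and> x > 0)"

end

theory Submission
  imports Defs
begin

text \<open>Write \<open>q a\<close> for the tail and \<open>d a\<close> for the density of the Gamma distribution of shape \<open>a\<close>.
  Expanding the Bessel function gives \<open>Q mu x y = exp (- x) * (\<Sum>n. q (mu + n) y * x ^ n / n!)\<close>, so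
  that \<open>Q\<close> is a Poisson mixture of Gamma tails and \<open>\<partial>Q mu / \<partial>y = - f mu\<close>, where \<open>f mu\<close> is the same
  mixture of the densities. Moreover \<open>Q (mu + 1) = Q mu + f (mu + 1)\<close>, whence \<open>H > 1\<close>, and
  \<open>c mu = f (mu + 1) / f mu\<close>. Comparing integrands shows that \<open>q a / d a\<close> increases with \<open>a\<close>,
  hence that \<open>q (a + 1) / q a\<close> decreases. A Chebyshev-type inequality carries both facts over to the
  mixtures: the first becomes \<open>H > c\<close> and the second says that \<open>H\<close> decreases in \<open>mu\<close>.
  The other two monotonicity claims follow by differentiation: the sign of \<open>\<partial>H / \<partial>y\<close> is that of
  \<open>H - c\<close>, and \<open>\<partial>H mu / \<partial>x = H mu * (H (mu + 1) - H mu)\<close>.\<close>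

section \<open>Exponential generating functions and a Chebyshev-type inequality\<close>

definition egf :: "(nat \<Rightarrow> real) \<Rightarrow> real \<Rightarrow> real" where
  "egf A x = (\<Sum>n. A n * x ^ n / fact n)"

lemma summable_egf:
  fixes A :: "nat \<Rightarrow> real"
  assumes "\<And>n. \<bar>A n\<bar> \<le> C"
  shows "summable (\<lambda>n. A n * x ^ n / fact n)"
proof (rule summable_comparison_test'[of _ 0])
  show "summable (\<lambda>n. C * (\<bar>x\<bar> ^ n /\<^sub>R fact n))"
    by (intro summable_mult summable_exp_generic)
  show "norm (A n * x ^ n / fact n) \<le> C * (\<bar>x\<bar> ^ n /\<^sub>R fact n)" for n
    using mult_right_mono[OF assms[of n], of "\<bar>x\<bar> ^ n / fact n"]
    by (simp add: abs_mult power_abs field_simps)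
qed

text \<open>Since \<open>0 ^ 0 = 1\<close>, the head term survives. This lets the series formulas
  below include the boundary case \<open>x = 0\<close>.\<close>

lemma egf_0 [simp]: "egf A 0 = A 0"
proof -
  have "egf A 0 = (\<Sum>n\<in>{0}. A n * 0 ^ n / fact n)"
    unfolding egf_def by (rule suminf_finite) auto
  then show ?thesis by simp
qed

lemma egf_add:
  assumes "\<And>n. \<bar>A n\<bar> \<le> C" "\<And>n. \<bar>B n\<bar> \<le> D"
  shows "egf (\<lambda>n. A n + B n) x = egf A x + egf B x"
  unfolding egf_def
  by (subst suminf_add[OF summable_egf[OF assms(1)] summable_egf[OF assms(2)]])
     (simp add: add_divide_distrib distrib_right)

lemma DERIV_egf:
  assumes "\<And>n. \<bar>A n\<bar> \<le> C"
  shows "(egf A has_real_derivative egf (\<lambda>n. A (Suc n)) x) (at x)"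
proof -
  have sm: "summable (\<lambda>n. (A n / fact n) * z ^ n)" for z
    using summable_egf[OF assms, where x = z] by simp
  have "diffs (\<lambda>n. A n / fact n) n = A (Suc n) / fact n" for n
    by (simp add: diffs_def divide_simps del: of_nat_Suc)
  with termdiffs_strong_converges_everywhere[OF sm, of x] show ?thesis
    unfolding egf_def by simp
qed

lemma egf_pos:
  assumes "\<And>n. \<bar>A n\<bar> \<le> C" "\<And>n. 0 \<le> A n" "0 \<le> x" "0 < A k" "k = 0 \<or> 0 < x"
  shows "0 < egf A x"
  unfolding egf_def
proof (rule suminf_pos2[where i = k])
  show "summable (\<lambda>n. A n * x ^ n / fact n)" by (rule summable_egf[OF assms(1)])
  show "0 \<le> A n * x ^ n / fact n" for n using assms by simp
  show "0 < A k * x ^ k / fact k" using assms by auto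
qed

text \<open>Symmetrisation: twice the difference of the two products is the double sum of the
  defects in \<open>le\<close>, each nonnegative and one of them positive. Partial sums make this a
  finite identity, so that no product of infinite series has to be rearranged.\<close>

lemma suminf_mult_less:
  fixes a b c d :: "nat \<Rightarrow> real"
  assumes sum: "summable a" "summable b" "summable c" "summable d"
    and le: "\<And>m n. a n * d m + a m * d n \<le> b n * c m + b m * c n"
    and less: "a i * d j + a j * d i < b i * c j + b j * c i"
  shows "suminf a * suminf d < suminf b * suminf c"
proof -
  define K where "K n m = (b n * c m + b m * c n) - (a n * d m + a m * d n)" for n m
  have K: "2 * (sum b {..<N} * sum c {..<N} - sum a {..<N} * sum d {..<N})
      = (\<Sum>n<N. \<Sum>m<N. K n m)" for N
  proof -
    have sym: "(\<Sum>n<N. \<Sum>m<N. f n * g m + f m * g n) = 2 * (sum f {..<N} * sum g {..<N})"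
      for f g :: "nat \<Rightarrow> real"
    proof -
      have "(\<Sum>n<N. \<Sum>m<N. f m * g n) = (\<Sum>n<N. \<Sum>m<N. f n * g m)"
        by (rule sum.swap)
      then show ?thesis by (simp add: sum.distrib sum_product)
    qed
    show ?thesis by (simp add: K_def sum_subtractf sym)
  qed
  \<comment> \<open>A strict inequality need not survive a limit. The fixed positive term
    \<open>K i j\<close> bounds the partial sums from below independently of \<open>N\<close>, and
    this bound does survive.\<close>
  have bound: "K i j \<le> 2 * (sum b {..<N} * sum c {..<N} - sum a {..<N} * sum d {..<N})"
    if "N \<ge> Suc (max i j)" for N
  proof -
    have K0: "0 \<le> K n m" for n m using le[of n m] by (simp add: K_def)
    have "K i j \<le> (\<Sum>m<N. K i m)"
      using that K0 by (intro member_le_sum) auto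
    also have "\<dots> \<le> (\<Sum>n<N. \<Sum>m<N. K n m)"
      using that K0 by (intro member_le_sum[where f = "\<lambda>n. \<Sum>m<N. K n m"] sum_nonneg) auto
    finally show ?thesis by (simp only: K)
  qed
  have "(\<lambda>N. 2 * (sum b {..<N} * sum c {..<N} - sum a {..<N} * sum d {..<N}))
      \<longlonglongrightarrow> 2 * (suminf b * suminf c - suminf a * suminf d)"
    by (intro tendsto_intros summable_LIMSEQ sum)
  from LIMSEQ_le_const[OF this] bound
  have "K i j \<le> 2 * (suminf b * suminf c - suminf a * suminf d)" by blast
  moreover have "0 < K i j" using less by (simp add: K_def)
  ultimately show ?thesis by simp
qed

text \<open>Multiplied by \<open>x\<close>, the shifted series becomes the series weighted by its index, so that
  the claim for \<open>x > 0\<close> is Chebyshev's sum inequality for the index and the decreasing ratio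
  \<open>A n / B n\<close>.\<close>

lemma egf_Suc_mult_less:
  assumes bdA: "\<And>n. \<bar>A n\<bar> \<le> C" and bdB: "\<And>n. \<bar>B n\<bar> \<le> D" and x: "0 \<le> x"
    and le: "\<And>m n. m < n \<Longrightarrow> A n * B m \<le> A m * B n"
    and less: "i < j" "A j * B i < A i * B j" "x = 0 \<Longrightarrow> i = 0 \<and> j = 1"
  shows "egf (\<lambda>n. A (Suc n)) x * egf B x < egf A x * egf (\<lambda>n. B (Suc n)) x"
proof (cases "x = 0")
  case True
  \<comment> \<open>Here the claim is \<open>A 1 * B 0 < A 0 * B 1\<close>, which is why the
    witnesses are then required to be \<open>0\<close> and \<open>1\<close>.\<close>
  with less show ?thesis by simp
next
  case False
  with x have x: "0 < x" by simp
  have shift: "summable (\<lambda>n. real n * (F n * x ^ n / fact n))"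
      "(\<Sum>n. real n * (F n * x ^ n / fact n)) = x * egf (\<lambda>n. F (Suc n)) x"
    if bd: "\<And>n. \<bar>F n\<bar> \<le> E" for F E
  proof -
    have eq: "real (Suc n) * (F (Suc n) * x ^ Suc n / fact (Suc n))
        = x * (F (Suc n) * x ^ n / fact n)" for n
      by (simp add: divide_simps del: of_nat_Suc)
    have sm: "summable (\<lambda>n. x * (F (Suc n) * x ^ n / fact n))"
      by (intro summable_mult summable_egf[where C = E] bd)
    then show s: "summable (\<lambda>n. real n * (F n * x ^ n / fact n))"
      by (subst summable_Suc_iff[symmetric]) (simp only: eq)
    show "(\<Sum>n. real n * (F n * x ^ n / fact n)) = x * egf (\<lambda>n. F (Suc n)) x"
      using suminf_split_head[OF s] suminf_mult[OF summable_egf[of "\<lambda>n. F (Suc n)", OF bd]]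
      unfolding eq egf_def by simp
  qed
  \<comment> \<open>The symmetrised defect required by \<open>suminf_mult_less\<close> factors into
    positive weights and a product of two differences. By \<open>nn\<close> these differences never
    have opposite signs.\<close>
  have pair: "(real n * (A n * x ^ n / fact n)) * (B m * x ^ m / fact m)
        + (real m * (A m * x ^ m / fact m)) * (B n * x ^ n / fact n)
      = (A n * x ^ n / fact n) * (real m * (B m * x ^ m / fact m))
        + (A m * x ^ m / fact m) * (real n * (B n * x ^ n / fact n))
        - (x ^ n / fact n) * (x ^ m / fact m) * ((real n - real m) * (A m * B n - A n * B m))" for n m
    by (simp add: field_simps)
  have nn: "0 \<le> (real n - real m) * (A m * B n - A n * B m)" for n m
  proof (cases m n rule: linorder_cases)
    case less
    then show ?thesis using le[of m n] by simp
  next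
    case greater
    then show ?thesis using le[of n m] by (intro mult_nonpos_nonpos) (auto simp: mult_ac)
  qed simp
  have "(\<Sum>n. real n * (A n * x ^ n / fact n)) * (\<Sum>n. B n * x ^ n / fact n)
      < (\<Sum>n. A n * x ^ n / fact n) * (\<Sum>n. real n * (B n * x ^ n / fact n))"
  proof (rule suminf_mult_less[where i = j and j = i])
    show "real n * (A n * x ^ n / fact n) * (B m * x ^ m / fact m)
        + real m * (A m * x ^ m / fact m) * (B n * x ^ n / fact n)
      \<le> A n * x ^ n / fact n * (real m * (B m * x ^ m / fact m))
        + A m * x ^ m / fact m * (real n * (B n * x ^ n / fact n))" for m n
      unfolding pair using nn[of n m] x by simp
    have "0 < (real j - real i) * (A i * B j - A j * B i)"
      using less by (intro mult_pos_pos) auto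
    then show "real j * (A j * x ^ j / fact j) * (B i * x ^ i / fact i)
        + real i * (A i * x ^ i / fact i) * (B j * x ^ j / fact j)
      < A j * x ^ j / fact j * (real i * (B i * x ^ i / fact i))
        + A i * x ^ i / fact i * (real j * (B j * x ^ j / fact j))"
      unfolding pair using x by simp
  qed (use shift(1)[OF bdA] shift(1)[OF bdB] summable_egf[OF bdA] summable_egf[OF bdB] in auto)
  then have "x * (egf (\<lambda>n. A (Suc n)) x * egf B x) < x * (egf A x * egf (\<lambda>n. B (Suc n)) x)"
    unfolding shift(2)[OF bdA] shift(2)[OF bdB] by (simp add: egf_def mult_ac)
  with x show ?thesis by simp
qed

section \<open>Gamma densities and tails, and log-concavity in the shape\<close>

definition gamma_density :: "real \<Rightarrow> real \<Rightarrow> real" where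
  "gamma_density a t = t powr (a - 1) * exp (- t) * rGamma a"

text \<open>Since \<open>rGamma 0 = 0\<close>, both functions vanish for \<open>a = 0\<close>, so that the case \<open>mu = 0\<close> needs no
  separate treatment.\<close>
definition gamma_tail :: "real \<Rightarrow> real \<Rightarrow> real" where
  "gamma_tail a y = integral {y..} (gamma_density a)"

lemma gamma_density_nonneg: "0 \<le> a \<Longrightarrow> 0 \<le> gamma_density a t"
  by (cases "a = 0") (auto simp: gamma_density_def rGamma_inverse_Gamma)

lemma gamma_density_pos: "0 < a \<Longrightarrow> 0 < t \<Longrightarrow> 0 < gamma_density a t"
  by (simp add: gamma_density_def rGamma_inverse_Gamma)

lemma gamma_density_0 [simp]: "gamma_density 0 t = 0"
  by (simp add: gamma_density_def)

lemma gamma_tail_0 [simp]: "gamma_tail 0 y = 0"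
proof -
  have "gamma_density 0 = (\<lambda>_. 0)" by auto
  then show ?thesis by (simp add: gamma_tail_def)
qed

lemma gamma_density_Suc:
  assumes "0 < a" "0 < t"
  shows "gamma_density (a + 1) t = t / a * gamma_density a t"
proof -
  have "t powr a = t * t powr (a - 1)" using assms by (simp add: powr_diff)
  moreover have "rGamma (a + 1) = rGamma a / a"
    using rGamma_plus1[of a] assms by (simp add: field_simps)
  ultimately show ?thesis by (simp add: gamma_density_def)
qed

lemma continuous_on_gamma_density: "0 < y \<Longrightarrow> continuous_on {y..z} (gamma_density a)"
  unfolding gamma_density_def by (intro continuous_intros) auto

lemma gamma_density_has_integral:
  assumes "0 < a"
  shows "(gamma_density a has_integral 1) {0..}"
proof -
  have "((\<lambda>t. t powr (a - 1) / exp t * rGamma a) has_integral (Gamma a * rGamma a)) {0..}"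
    by (intro has_integral_mult_left Gamma_integral_real assms)
  moreover have "(\<lambda>t. t powr (a - 1) / exp t * rGamma a) = gamma_density a"
    by (auto simp: gamma_density_def exp_minus field_simps)
  moreover have "Gamma a * rGamma a = 1"
    using Gamma_real_pos[OF assms] by (simp add: rGamma_inverse_Gamma)
  ultimately show ?thesis by simp
qed

lemma gamma_density_integrable:
  assumes "0 \<le> a" "0 \<le> y"
  shows "gamma_density a integrable_on {y..}"
proof (cases "a = 0")
  case True
  have "gamma_density 0 = (\<lambda>_. 0)" by auto
  with True show ?thesis by (auto simp: integrable_on_def intro: has_integral_0)
next
  case False
  \<comment> \<open>A nonnegative integrable function is absolutely integrable, and absolute
    integrability passes to measurable subsets.\<close>
  have "gamma_density a absolutely_integrable_on {0..}"
    using assms False gamma_density_has_integral[of a]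
    by (intro nonnegative_absolutely_integrable_1 gamma_density_nonneg) (auto simp: integrable_on_def)
  then have "gamma_density a absolutely_integrable_on {y..}"
    by (rule set_integrable_subset) (use assms in auto)
  then show ?thesis by (rule set_lebesgue_integral_eq_integral)
qed

lemma gamma_tail_has_integral:
  "0 \<le> a \<Longrightarrow> 0 \<le> y \<Longrightarrow> (gamma_density a has_integral gamma_tail a y) {y..}"
  unfolding gamma_tail_def using gamma_density_integrable by (simp add: has_integral_integral)

lemma gamma_tail_nonneg: "0 \<le> a \<Longrightarrow> 0 \<le> y \<Longrightarrow> 0 \<le> gamma_tail a y"
  using has_integral_nonneg[OF gamma_tail_has_integral] gamma_density_nonneg by blast

lemma gamma_tail_le_1:
  assumes "0 \<le> a" "0 \<le> y"
  shows "gamma_tail a y \<le> 1"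
proof (cases "a = 0")
  case False
  with assms have "0 < a" by simp
  show ?thesis
    by (rule has_integral_subset_le[OF _ gamma_tail_has_integral[OF assms]
          gamma_density_has_integral[OF \<open>0 < a\<close>]])
      (use assms gamma_density_nonneg in auto)
qed simp

text \<open>Strictness is gained on \<open>{y..y+1}\<close> by continuity, and the rest of the
  half-line contributes a nonnegative amount. Equality at \<open>t = y\<close> has to be allowed,
  because the integrands compared in \<open>gamma_tail_mult_density_less\<close> agree
  there.\<close>

lemma has_integral_atLeast_less:
  fixes f g :: "real \<Rightarrow> real"
  assumes f: "(f has_integral I) {y..}" and g: "(g has_integral J) {y..}"
    and cont: "continuous_on {y..y+1} f" "continuous_on {y..y+1} g"
    and less: "\<And>t. y < t \<Longrightarrow> f t < g t"
  shows "I < J"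
proof -
  let ?h = "\<lambda>t. g t - f t"
  have h: "(?h has_integral (J - I)) {y..}" by (intro has_integral_diff f g)
  \<comment> \<open>The endpoint inequality is the limit from the right of the strict ones.\<close>
  have "f y \<le> g y"
  proof (rule tendsto_le[of "at y within {y<..<y+1}"])
    have "(f \<longlongrightarrow> f y) (at y within {y..y+1})" "(g \<longlongrightarrow> g y) (at y within {y..y+1})"
      using cont by (auto simp: continuous_on_def)
    then show "(f \<longlongrightarrow> f y) (at y within {y<..<y+1})" "(g \<longlongrightarrow> g y) (at y within {y<..<y+1})"
      by (auto elim!: tendsto_within_subset)
    show "eventually (\<lambda>t. f t \<le> g t) (at y within {y<..<y+1})"
      using less by (auto simp: eventually_at_filter intro!: always_eventually less_imp_le)
    have "y islimpt {y<..<y+1}" by (rule islimpt_greaterThanLessThan1) simp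
    then show "at y within {y<..<y+1} \<noteq> bot" by (simp add: trivial_limit_within)
  qed
  with less have nn: "0 \<le> ?h t" if "t \<in> {y..}" for t
    using that by (cases "t = y") (auto intro: less_imp_le)
  have ch: "continuous_on {y..y+1} ?h" by (intro continuous_on_diff cont)
  have "integral {y..y+1} (\<lambda>_. 0) < integral {y..y+1} ?h"
    using less by (intro integral_less_real continuous_on_const ch) auto
  also have "\<dots> \<le> J - I"
    by (rule has_integral_subset_le[OF _ integrable_integral[OF integrable_continuous_interval[OF ch]] h])
       (use nn in auto)
  finally show ?thesis by simp
qed

lemma gamma_tail_pos:
  assumes "0 < a" "0 < y"
  shows "0 < gamma_tail a y"
proof (rule has_integral_atLeast_less)
  show "((\<lambda>_. 0) has_integral (0::real)) {y..}" by simp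
  show "(gamma_density a has_integral gamma_tail a y) {y..}"
    using assms by (intro gamma_tail_has_integral) auto
qed (use assms gamma_density_pos continuous_on_gamma_density in auto)

text \<open>The ratio \<open>gamma_density b t / gamma_density a t\<close> is a constant times
  \<open>t powr (b - a)\<close>, hence increasing in \<open>t\<close>. Comparing it with its value
  at \<open>y\<close> and integrating over \<open>t > y\<close> gives the claim.\<close>

lemma gamma_tail_mult_density_less:
  assumes "0 < a" "a < b" "0 < y"
  shows "gamma_tail a y * gamma_density b y < gamma_tail b y * gamma_density a y"
proof (rule has_integral_atLeast_less)
  show "((\<lambda>t. gamma_density a t * gamma_density b y) has_integral
      gamma_tail a y * gamma_density b y) {y..}"
    "((\<lambda>t. gamma_density b t * gamma_density a y) has_integral
      gamma_tail b y * gamma_density a y) {y..}"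
    using assms by (intro has_integral_mult_left gamma_tail_has_integral; simp)+
  show "gamma_density a t * gamma_density b y < gamma_density b t * gamma_density a y"
    if t: "y < t" for t
  proof -
    have "0 < t" using t assms by simp
    have powr: "z powr (b - 1) = z powr (b - a) * z powr (a - 1)" if "0 < z" for z :: real
      using that by (simp add: powr_add[symmetric])
    have "y powr (b - a) < t powr (b - a)"
      using t assms by (intro powr_less_mono2) auto
    moreover have "0 < rGamma a" "0 < rGamma b"
      using assms by (simp_all add: rGamma_inverse_Gamma)
    ultimately show ?thesis
      using \<open>0 < t\<close> assms unfolding gamma_density_def powr[OF \<open>0 < t\<close>] powr[OF \<open>0 < y\<close>]
      by (simp add: mult_ac)
  qed
qed (use assms continuous_on_gamma_density in \<open>auto intro!: continuous_intros\<close>)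

text \<open>Integration by parts. This recurrence, summed over the mixture, is the source of
  \<open>H > 1\<close>.\<close>

lemma gamma_tail_add_1:
  assumes "0 \<le> a" "0 < y"
  shows "gamma_tail (a + 1) y = gamma_tail a y + gamma_density (a + 1) y"
proof (cases "a = 0")
  case True
  have "((\<lambda>t. exp (- t)) has_integral exp (- y)) {y..}"
    using has_integral_exp_minus_to_infinity[of 1 y] by simp
  then have "(gamma_density 1 has_integral exp (- y)) {y..}"
    by (rule has_integral_eq[rotated]) (use assms in \<open>simp add: gamma_density_def\<close>)
  then show ?thesis
    using True assms
    by (simp add: gamma_tail_def[of 1] integral_unique) (simp add: gamma_density_def)
next
  case False
  with assms have a: "0 < a" by simp
  \<comment> \<open>\<open>?F\<close> is \<open>gamma_density (a + 1)\<close>, with derivative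
    \<open>gamma_density a - gamma_density (a + 1)\<close> for \<open>t > 0\<close>. Tails are
    complements of integrals over \<open>{0..y}\<close>, so that the boundary value
    \<open>?F 0 = 0\<close> replaces a limit at infinity.\<close>
  let ?F = "\<lambda>t. t powr a * exp (- t) * rGamma (a + 1)"
  have split: "gamma_tail b y = 1 - integral {0..y} (gamma_density b)"
    "gamma_density b integrable_on {0..y}" if b: "0 < b" for b
  proof -
    have "gamma_density b absolutely_integrable_on {0..}"
      using b gamma_density_has_integral[of b]
      by (intro nonnegative_absolutely_integrable_1 gamma_density_nonneg) (auto simp: integrable_on_def)
    then have "gamma_density b absolutely_integrable_on {0..y}"
      by (rule set_integrable_subset) auto
    then show int: "gamma_density b integrable_on {0..y}"
      by (rule set_lebesgue_integral_eq_integral)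
    have "(gamma_density b has_integral (integral {0..y} (gamma_density b) + gamma_tail b y))
        ({0..y} \<union> {y..})"
      using b assms int
      by (intro has_integral_Un integrable_integral gamma_tail_has_integral)
         (auto intro: negligible_subset[of "{y}"])
    moreover have "{0..y} \<union> {y..} = {0..}" using assms by auto
    ultimately have "integral {0..y} (gamma_density b) + gamma_tail b y = 1"
      using gamma_density_has_integral[OF b] has_integral_unique by metis
    then show "gamma_tail b y = 1 - integral {0..y} (gamma_density b)" by simp
  qed
  have "((\<lambda>t. gamma_density a t - gamma_density (a + 1) t) has_integral (?F y - ?F 0)) {0..y}"
  \<comment> \<open>For \<open>a < 1\<close> the function \<open>?F\<close> is not differentiable at
    \<open>0\<close>; the interior version asks only for continuity there.\<close>
  proof (rule fundamental_theorem_of_calculus_interior)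
    show "continuous_on {0..y} ?F"
      using a by (intro continuous_intros continuous_on_powr') auto
    fix t assume t: "t \<in> {0<..<y}"
    have "rGamma a = a * rGamma (a + 1)" using rGamma_plus1[of a] by simp
    with t have "(?F has_real_derivative gamma_density a t - gamma_density (a + 1) t) (at t)"
      unfolding gamma_density_def
      by (auto intro!: derivative_eq_intros simp: algebra_simps)
    then show "(?F has_vector_derivative gamma_density a t - gamma_density (a + 1) t) (at t)"
      by (simp add: has_real_derivative_iff_has_vector_derivative)
  qed (use assms in simp)
  then have "integral {0..y} (gamma_density a) - integral {0..y} (gamma_density (a + 1)) = ?F y"
    using split(2)[of a] split(2)[of "a + 1"] a
    by (simp add: has_integral_iff integral_diff)
  with split(1)[of a] split(1)[of "a + 1"] a show ?thesis
    by (simp add: gamma_density_def)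
qed

text \<open>The density is a difference of two tails, both in \<open>[0, 1]\<close>. This bounds the
  coefficients of the density series uniformly in the index.\<close>

lemma gamma_density_le_1:
  assumes "0 \<le> a" "0 < y"
  shows "gamma_density (a + 1) y \<le> 1"
  using gamma_tail_add_1[OF assms] gamma_tail_le_1[of "a + 1" y] gamma_tail_nonneg[of a y] assms
  by simp

text \<open>Expanding both \<open>+ 1\<close> tails by \<open>gamma_tail_add_1\<close> cancels a
  common product. What remains follows from
  \<open>gamma_density (a + 1) y = y / a * gamma_density a y\<close>, the comparison of tails with
  densities, and \<open>1 / a < 1 / b\<close>; for \<open>b = 0\<close> its left side
  vanishes.\<close>

lemma gamma_tail_log_concave_step:
  assumes "0 \<le> b" "b < a" "0 < y"
  shows "gamma_tail (a + 1) y * gamma_tail b y < gamma_tail a y * gamma_tail (b + 1) y"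
proof -
  have "gamma_density (a + 1) y * gamma_tail b y < gamma_tail a y * gamma_density (b + 1) y"
  proof (cases "b = 0")
    case True
    then show ?thesis
      using assms gamma_tail_pos[of a y] gamma_density_pos[of 1 y] by simp
  next
    case False
    then have b: "0 < b" using assms by simp
    have "gamma_density (a + 1) y * gamma_tail b y = y / a * (gamma_tail b y * gamma_density a y)"
      using gamma_density_Suc[of a y] assms by simp
    also have "\<dots> < y / a * (gamma_tail a y * gamma_density b y)"
      using gamma_tail_mult_density_less[of b a y] assms b by (intro mult_strict_left_mono) auto
    also have "\<dots> \<le> y / b * (gamma_tail a y * gamma_density b y)"
      using assms b gamma_tail_nonneg[of a y] gamma_density_nonneg[of b y]
      by (intro mult_right_mono mult_nonneg_nonneg divide_left_mono) auto
    also have "\<dots> = gamma_tail a y * gamma_density (b + 1) y"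
      using gamma_density_Suc[of b y] assms b by simp
    finally show ?thesis .
  qed
  with gamma_tail_add_1[of a y] gamma_tail_add_1[of b y] assms show ?thesis
    by (simp add: algebra_simps)
qed

text \<open>Chaining \<open>k\<close> unit steps; the mixture inequality needs every gap between two
  indices.\<close>

lemma gamma_tail_log_concave:
  assumes "0 \<le> b" "b < a" "0 < y" "0 < k"
  shows "gamma_tail (a + real k) y * gamma_tail b y < gamma_tail a y * gamma_tail (b + real k) y"
  using \<open>0 < k\<close>
proof (induction k rule: nat_induct_non_zero)
  case 1
  then show ?case using gamma_tail_log_concave_step assms by simp
next
  case (Suc k)
  let ?q = "\<lambda>c. gamma_tail c y"
  have pos: "0 < ?q (a + real k)" "0 < ?q (b + real k)" "0 < ?q a" "0 < ?q (b + real k + 1)"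
    using assms Suc.hyps by (auto intro!: gamma_tail_pos)
  \<comment> \<open>\<open>?q b\<close> vanishes for \<open>b = 0\<close>, so the unit step is used
    only weakly here; strictness comes from the induction hypothesis. The positive factor
    \<open>?q (b + real k)\<close> is cancelled at the end.\<close>
  have "?q (a + real k + 1) * ?q b * ?q (b + real k) \<le> ?q (a + real k) * ?q b * ?q (b + real k + 1)"
    using gamma_tail_log_concave_step[of "b + real k" "a + real k" y] assms gamma_tail_nonneg[of b y]
      mult_right_mono[of "?q (a + real k + 1) * ?q (b + real k)" "?q (a + real k) * ?q (b + real k + 1)" "?q b"]
    by (simp add: mult_ac)
  also have "\<dots> < ?q a * ?q (b + real k) * ?q (b + real k + 1)"
    using Suc.IH pos by simp
  finally show ?case using pos by (simp add: mult_ac add_ac)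
qed

section \<open>Bounds, positivity and series representations of the mixtures\<close>

lemma gamma_tail_bounded: "0 \<le> mu \<Longrightarrow> 0 \<le> y \<Longrightarrow> \<bar>gamma_tail (mu + real n) y\<bar> \<le> 1"
  using gamma_tail_nonneg[of "mu + real n" y] gamma_tail_le_1[of "mu + real n" y] by simp

text \<open>For \<open>n > 0\<close> the shape is at least \<open>1\<close> and
  \<open>gamma_density_le_1\<close> applies. For \<open>n = 0\<close> the shape may be smaller and
  the density at \<open>y\<close> may exceed \<open>1\<close>, hence the maximum.\<close>

lemma gamma_density_bounded:
  assumes "0 \<le> mu" "0 < y"
  shows "\<bar>gamma_density (mu + real n) y\<bar> \<le> max 1 (gamma_density mu y)"
proof (cases n)
  case 0
  then show ?thesis using gamma_density_nonneg[of mu y] assms by simp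
next
  case (Suc m)
  then show ?thesis
    using gamma_density_nonneg[of "mu + real n" y] gamma_density_le_1[of "mu + real m" y] assms
    by (simp add: add_ac)
qed

text \<open>At \<open>t = 1\<close> the density is \<open>rGamma\<close> up to the factor
  \<open>exp (- 1)\<close>, so the density bound carries over.\<close>

lemma rGamma_bounded:
  assumes "0 \<le> mu"
  shows "\<bar>rGamma (mu + real n)\<bar> \<le> exp 1 * max 1 (gamma_density mu 1)"
proof -
  have "rGamma (mu + real n) = exp 1 * gamma_density (mu + real n) 1"
    by (simp add: gamma_density_def exp_minus)
  then show ?thesis
    using gamma_density_bounded[OF assms, of 1 n] by (simp add: abs_mult)
qed

lemma egf_gamma_tail_pos:
  assumes "admissible mu x" "0 < y"
  shows "0 < egf (\<lambda>n. gamma_tail (mu + real n) y) x"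
\<comment> \<open>For \<open>mu = 0\<close> the term \<open>n = 0\<close> vanishes. The term
  \<open>n = 1\<close> then takes over, as admissibility gives \<open>x > 0\<close> in that
  case.\<close>
proof (rule egf_pos[where k = "if mu = 0 then 1 else 0" and C = 1])
  show "0 < gamma_tail (mu + real (if mu = 0 then 1 else 0)) y"
    using assms by (auto simp: admissible_def intro!: gamma_tail_pos)
qed (use assms in \<open>auto simp: admissible_def intro!: gamma_tail_bounded gamma_tail_nonneg\<close>)

lemma egf_gamma_density_pos:
  assumes "admissible mu x" "0 < y"
  shows "0 < egf (\<lambda>n. gamma_density (mu + real n) y) x"
proof (rule egf_pos[where k = "if mu = 0 then 1 else 0"])
  show "0 < gamma_density (mu + real (if mu = 0 then 1 else 0)) y"
    using assms by (auto simp: admissible_def intro!: gamma_density_pos)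
  show "\<bar>gamma_density (mu + real n) y\<bar> \<le> max 1 (gamma_density mu y)" for n
    using assms by (intro gamma_density_bounded) (auto simp: admissible_def)
qed (use assms in \<open>auto simp: admissible_def intro!: gamma_density_nonneg\<close>)

lemma egf_gamma_density:
  assumes "0 \<le> mu" "0 < t"
  shows "egf (\<lambda>n. gamma_density (mu + real n) t) x
    = t powr (mu - 1) * exp (- t) * egf (\<lambda>n. rGamma (mu + real n)) (x * t)"
proof -
  \<comment> \<open>The factor \<open>t ^ n\<close> of the density joins \<open>x ^ n\<close>,
    leaving the series in \<open>x * t\<close> that also underlies the Bessel function.\<close>
  have "gamma_density (mu + real n) t * x ^ n / fact n
      = (t powr (mu - 1) * exp (- t)) * (rGamma (mu + real n) * (x * t) ^ n / fact n)" for n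
  proof -
    have "t powr (mu + real n - 1) = t powr (mu - 1) * t ^ n"
      using assms by (simp add: powr_realpow[symmetric] powr_add[symmetric] algebra_simps)
    then show ?thesis by (simp add: gamma_density_def power_mult_distrib)
  qed
  then show ?thesis
    unfolding egf_def
    by (simp only: suminf_mult[OF summable_egf[OF rGamma_bounded[OF assms(1)]]])
qed

lemma besselI_2_sqrt:
  assumes "0 \<le> mu" "0 < z"
  shows "besselI (mu - 1) (2 * sqrt z) = z powr ((mu - 1) / 2) * egf (\<lambda>n. rGamma (mu + real n)) z"
proof -
  have "(2 * sqrt z / 2) powr (2 * real n + (mu - 1)) * rGamma (real n + (mu - 1) + 1) / fact n
      = z powr ((mu - 1) / 2) * (rGamma (mu + real n) * z ^ n / fact n)" for n
  proof -
    have "sqrt z powr (2 * real n + (mu - 1)) = z powr (real n + (mu - 1) / 2)"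
      using assms by (simp add: powr_half_sqrt[symmetric] powr_powr field_simps)
    also have "\<dots> = z powr ((mu - 1) / 2) * z ^ n"
      using assms by (simp add: powr_add powr_realpow)
    finally show ?thesis by (simp add: add_ac)
  qed
  then show ?thesis
    unfolding besselI_def egf_def
    by (simp only: suminf_mult[OF summable_egf[OF rGamma_bounded[OF assms(1)]]])
qed

text \<open>Termwise integration by monotone convergence: all terms are nonnegative, so the partial
  sums increase.\<close>

lemma egf_gamma_density_has_integral:
  assumes "0 \<le> mu" "0 \<le> x" "0 < y"
  shows "((\<lambda>t. egf (\<lambda>n. gamma_density (mu + real n) t) x) has_integral
    egf (\<lambda>n. gamma_tail (mu + real n) y) x) {y..}"
proof (rule has_integral_monotone_convergence_increasing)
  show "((\<lambda>t. \<Sum>n<k. gamma_density (mu + real n) t * (x ^ n / fact n)) has_integral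
      (\<Sum>n<k. gamma_tail (mu + real n) y * (x ^ n / fact n))) {y..}" for k
    using assms by (intro has_integral_sum has_integral_mult_left gamma_tail_has_integral) auto
  show "(\<Sum>n<k. gamma_density (mu + real n) t * (x ^ n / fact n))
      \<le> (\<Sum>n<Suc k. gamma_density (mu + real n) t * (x ^ n / fact n))" for k t
    using assms gamma_density_nonneg[of "mu + real k" t] by simp
  show "(\<lambda>k. \<Sum>n<k. gamma_density (mu + real n) t * (x ^ n / fact n))
      \<longlonglongrightarrow> egf (\<lambda>n. gamma_density (mu + real n) t) x" if "t \<in> {y..}" for t
    using summable_LIMSEQ[OF summable_egf[OF gamma_density_bounded[of mu t]]] assms that
    by (simp add: egf_def)
  show "(\<lambda>k. \<Sum>n<k. gamma_tail (mu + real n) y * (x ^ n / fact n))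
      \<longlonglongrightarrow> egf (\<lambda>n. gamma_tail (mu + real n) y) x"
    using summable_LIMSEQ[OF summable_egf[OF gamma_tail_bounded[of mu y]]] assms
    by (simp add: egf_def)
qed

text \<open>For \<open>x > 0\<close>, inserting the Bessel series cancels the powers of
  \<open>x\<close> and combines those of \<open>t\<close> into \<open>t powr (mu - 1)\<close>, which
  leaves the density mixture to be integrated.\<close>

lemma marcumQ_eq_egf:
  assumes "admissible mu x" "0 < y"
  shows "marcumQ mu x y = exp (- x) * egf (\<lambda>n. gamma_tail (mu + real n) y) x"
proof (cases "x = 0")
  case True
  have "gamma_tail mu y = integral {y..} (\<lambda>t. t powr (mu - 1) * exp (- t)) * rGamma mu"
    unfolding gamma_tail_def gamma_density_def by simp
  with True show ?thesis by (simp add: marcumQ_def rGamma_inverse_Gamma divide_inverse)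
next
  case False
  with assms have x: "0 < x" and mu: "0 \<le> mu" by (auto simp: admissible_def)
  let ?g = "\<lambda>t. t powr ((mu - 1) / 2) * exp (- t - x) * besselI (mu - 1) (2 * sqrt (x * t))"
  have eq: "exp (- x) * egf (\<lambda>n. gamma_density (mu + real n) t) x = x powr ((1 - mu) / 2) * ?g t"
    if "t \<in> {y..}" for t
  proof -
    have t: "0 < t" using that assms by simp
    have "x powr ((1 - mu) / 2) * (t powr ((mu - 1) / 2) * (x * t) powr ((mu - 1) / 2))
      = (x powr ((1 - mu) / 2) * x powr ((mu - 1) / 2)) * (t powr ((mu - 1) / 2) * t powr ((mu - 1) / 2))"
      using x t by (simp add: powr_mult)
    also have "\<dots> = t powr (mu - 1)"
    proof -
      have "(1 - mu) / 2 + (mu - 1) / 2 = 0" "(mu - 1) / 2 + (mu - 1) / 2 = mu - 1"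
        by (simp_all add: field_simps)
      with x show ?thesis by (simp only: powr_add[symmetric]) simp
    qed
    finally have pw: "x powr ((1 - mu) / 2) * (t powr ((mu - 1) / 2) * (x * t) powr ((mu - 1) / 2))
      = t powr (mu - 1)" .
    have "x powr ((1 - mu) / 2) * ?g t
      = (x powr ((1 - mu) / 2) * (t powr ((mu - 1) / 2) * (x * t) powr ((mu - 1) / 2)))
        * (exp (- x) * exp (- t)) * egf (\<lambda>n. rGamma (mu + real n)) (x * t)"
      using x t besselI_2_sqrt[OF mu, of "x * t"] exp_add[of "- t" "- x"] by (simp add: mult_ac)
    then show ?thesis
      unfolding pw egf_gamma_density[OF mu t] by (simp add: mult_ac)
  qed
  have "((\<lambda>t. x powr ((1 - mu) / 2) * ?g t) has_integral
      exp (- x) * egf (\<lambda>n. gamma_tail (mu + real n) y) x) {y..}"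
    by (rule has_integral_eq[OF eq])
       (use egf_gamma_density_has_integral[of mu x y] mu x assms in \<open>auto intro: has_integral_mult_right\<close>)
  then have "integral {y..} (\<lambda>t. x powr ((1 - mu) / 2) * ?g t)
      = exp (- x) * egf (\<lambda>n. gamma_tail (mu + real n) y) x"
    by (rule integral_unique)
  with False show ?thesis by (simp add: marcumQ_def)
qed

text \<open>For \<open>x > 0\<close>, the two Bessel prefactors differ by
  \<open>sqrt (x * y)\<close>, which with \<open>sqrt (y / x)\<close> gives \<open>y\<close>. This
  is exactly the extra power of \<open>y\<close> in the densities of the numerator.\<close>

lemma cfun_eq_egf:
  assumes "admissible mu x" "0 < y"
  shows "cfun mu x y = egf (\<lambda>n. gamma_density (mu + 1 + real n) y) x
    / egf (\<lambda>n. gamma_density (mu + real n) y) x"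
proof (cases "x = 0")
  case True
  with assms have mu: "0 < mu" by (simp add: admissible_def)
  have "gamma_density (mu + 1) y / gamma_density mu y = y / mu"
    using gamma_density_Suc[OF mu assms(2)] gamma_density_pos[OF mu assms(2)] by simp
  with True show ?thesis by (simp add: cfun_def)
next
  case False
  with assms have x: "0 < x" and mu: "0 \<le> mu" by (auto simp: admissible_def)
  let ?R = "\<lambda>mu. egf (\<lambda>n. rGamma (mu + real n)) (x * y)"
  let ?p = "(x * y) powr ((mu - 1) / 2)"
  have p: "0 < ?p" "(x * y) powr (mu / 2) = sqrt (x * y) * ?p"
    using x assms by (simp_all add: powr_half_sqrt[symmetric] powr_add[symmetric] field_simps del: real_sqrt_mult)
  have "cfun mu x y = sqrt (y / x) * ((sqrt (x * y) * ?p) * ?R (mu + 1)) / (?p * ?R mu)"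
    using False besselI_2_sqrt[OF mu, of "x * y"] besselI_2_sqrt[of "mu + 1" "x * y"] mu x assms p(2)
    by (simp add: cfun_def del: real_sqrt_mult)
  also have "\<dots> = (sqrt (y / x) * sqrt (x * y)) * ?R (mu + 1) / ?R mu"
    using p(1) by (simp add: mult_ac)
  also have "sqrt (y / x) * sqrt (x * y) = y"
  proof -
    have "sqrt (y / x) * sqrt (x * y) = sqrt (y\<^sup>2)"
      unfolding real_sqrt_mult[symmetric] using x by (simp add: power2_eq_square)
    then show ?thesis using assms by simp
  qed
  also have "y * ?R (mu + 1) / ?R mu = egf (\<lambda>n. gamma_density (mu + 1 + real n) y) x
    / egf (\<lambda>n. gamma_density (mu + real n) y) x"
  proof -
    have "y powr mu = y * y powr (mu - 1)" using assms by (simp add: powr_diff)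
    moreover have "0 < y powr (mu - 1) * exp (- y)" using assms by simp
    ultimately show ?thesis
      using egf_gamma_density[OF mu assms(2), of x] egf_gamma_density[of "mu + 1" y x] mu assms
      by simp
  qed
  finally show ?thesis .
qed

lemma Hfun_eq_egf:
  assumes "admissible mu x" "0 < y"
  shows "Hfun mu x y = egf (\<lambda>n. gamma_tail (mu + 1 + real n) y) x
    / egf (\<lambda>n. gamma_tail (mu + real n) y) x"
proof -
  have "admissible (mu + 1) x" using assms(1) by (auto simp: admissible_def)
  with assms show ?thesis by (simp add: Hfun_def marcumQ_eq_egf)
qed

section \<open>Derivative in \<open>y\<close> and inequalities for the mixtures\<close>

lemma continuous_on_egf_gamma_density:
  assumes "0 \<le> mu" "0 < a"
  shows "continuous_on {a..b} (\<lambda>t. egf (\<lambda>n. gamma_density (mu + real n) t) x)"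
proof -
  have "continuous_on UNIV (egf (\<lambda>n. rGamma (mu + real n)))"
    using DERIV_isCont[OF DERIV_egf[OF rGamma_bounded[OF assms(1)]]]
    by (simp add: continuous_on_eq_continuous_at)
  then have "continuous_on {a..b} (\<lambda>t. egf (\<lambda>n. rGamma (mu + real n)) (x * t))"
    by (rule continuous_on_compose2) (auto intro!: continuous_intros)
  then have "continuous_on {a..b}
      (\<lambda>t. t powr (mu - 1) * exp (- t) * egf (\<lambda>n. rGamma (mu + real n)) (x * t))"
    using assms by (intro continuous_intros) auto
  then show ?thesis
    by (rule continuous_on_eq) (use assms egf_gamma_density in auto)
qed

text \<open>Near \<open>y\<close> the tail is an integral up to \<open>2 * y\<close> plus the
  constant tail beyond it, so the fundamental theorem applies at the lower limit. The interval
  \<open>{y / 2..2 * y}\<close> has \<open>y\<close> in its interior and stays away from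
  \<open>0\<close>.\<close>

lemma DERIV_egf_gamma_tail:
  assumes "0 \<le> mu" "0 \<le> x" "0 < y"
  shows "((\<lambda>y. egf (\<lambda>n. gamma_tail (mu + real n) y) x) has_real_derivative
    - egf (\<lambda>n. gamma_density (mu + real n) y) x) (at y)"
proof -
  let ?f = "\<lambda>t. egf (\<lambda>n. gamma_density (mu + real n) t) x"
  let ?F = "\<lambda>y. egf (\<lambda>n. gamma_tail (mu + real n) y) x"
  have cont: "continuous_on {a..b} ?f" if "0 < a" for a b
    using that assms by (intro continuous_on_egf_gamma_density)
  have int: "integral {s..2 * y} ?f + ?F (2 * y) = ?F s" if s: "s \<in> {y / 2..2 * y}" for s
  proof -
    have "(?f has_integral (integral {s..2 * y} ?f + ?F (2 * y))) ({s..2 * y} \<union> {2 * y..})"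
      using assms s
      by (intro has_integral_Un egf_gamma_density_has_integral integrable_integral
            integrable_continuous_interval cont)
         (auto intro: negligible_subset[of "{2 * y}"])
    moreover have "{s..2 * y} \<union> {2 * y..} = {s..}" using s assms by auto
    moreover have "(?f has_integral ?F s) {s..}"
      using assms s by (intro egf_gamma_density_has_integral) auto
    ultimately show ?thesis using has_integral_unique by metis
  qed
  have "((\<lambda>s. integral {s..2 * y} ?f) has_real_derivative - ?f y) (at y within {y / 2..2 * y})"
    using assms by (intro integral_has_real_derivative' cont) auto
  then have "((\<lambda>s. integral {s..2 * y} ?f + ?F (2 * y)) has_real_derivative - ?f y)
      (at y within {y / 2..2 * y})"
    by (auto intro!: derivative_eq_intros)
  then have "(?F has_real_derivative - ?f y) (at y within {y / 2..2 * y})"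
    by (rule has_field_derivative_transform_within[where d = 1]) (use assms int in auto)
  then show ?thesis
    using assms by (simp add: at_within_Icc_at)
qed

text \<open>Raising the order by one shifts the coefficient sequence, so
  \<open>egf_Suc_mult_less\<close> applies. The decreasing coefficient ratio is
  \<open>gamma_tail_log_concave\<close> with \<open>k = n - m\<close>.\<close>

lemma egf_gamma_tail_log_concave:
  assumes "admissible nu x" "nu < mu" "0 < y"
  shows "egf (\<lambda>n. gamma_tail (mu + 1 + real n) y) x * egf (\<lambda>n. gamma_tail (nu + real n) y) x
    < egf (\<lambda>n. gamma_tail (mu + real n) y) x * egf (\<lambda>n. gamma_tail (nu + 1 + real n) y) x"
proof -
  have nu: "0 \<le> nu" "0 \<le> x" using assms by (auto simp: admissible_def)
  have less: "gamma_tail (mu + real n) y * gamma_tail (nu + real m) y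
      < gamma_tail (mu + real m) y * gamma_tail (nu + real n) y" if "m < n" for m n
    using gamma_tail_log_concave[of "nu + real m" "mu + real m" y "n - m"] assms nu that by simp
  have "egf (\<lambda>n. gamma_tail (mu + real (Suc n)) y) x * egf (\<lambda>n. gamma_tail (nu + real n) y) x
    < egf (\<lambda>n. gamma_tail (mu + real n) y) x * egf (\<lambda>n. gamma_tail (nu + real (Suc n)) y) x"
  proof (rule egf_Suc_mult_less[where i = 0 and j = 1])
    show "\<bar>gamma_tail (mu + real n) y\<bar> \<le> 1" "\<bar>gamma_tail (nu + real n) y\<bar> \<le> 1" for n
      using nu assms by (auto intro!: gamma_tail_bounded)
    show "gamma_tail (mu + real n) y * gamma_tail (nu + real m) y
        \<le> gamma_tail (mu + real m) y * gamma_tail (nu + real n) y" if "m < n" for m n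
      using less[OF that] by simp
  qed (use nu less[of 0 1] in auto)
  then show ?thesis by (simp add: add_ac)
qed

lemma egf_gamma_density_tail_less:
  assumes "admissible mu x" "0 < y"
  shows "egf (\<lambda>n. gamma_density (mu + 1 + real n) y) x * egf (\<lambda>n. gamma_tail (mu + real n) y) x
    < egf (\<lambda>n. gamma_density (mu + real n) y) x * egf (\<lambda>n. gamma_tail (mu + 1 + real n) y) x"
proof -
  have mu: "0 \<le> mu" "0 \<le> x" using assms by (auto simp: admissible_def)
  have less: "gamma_density (mu + real n) y * gamma_tail (mu + real m) y
      < gamma_density (mu + real m) y * gamma_tail (mu + real n) y"
    if "m < n" "mu + real m > 0" for m n
    using gamma_tail_mult_density_less[of "mu + real m" "mu + real n" y] assms that
    by (simp add: mult_ac)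
  have le: "gamma_density (mu + real n) y * gamma_tail (mu + real m) y
      \<le> gamma_density (mu + real m) y * gamma_tail (mu + real n) y" if "m < n" for m n
  proof (cases "mu + real m = 0")
    case False
    then show ?thesis using less[OF that] mu by simp
  qed simp
  \<comment> \<open>For \<open>mu = 0\<close> both coefficients at index \<open>0\<close> vanish, so
    a strict comparison has to start at index \<open>1\<close>; for \<open>x = 0\<close>
    admissibility forces \<open>mu > 0\<close> and thus \<open>i = 0\<close>.\<close>
  define i :: nat where "i = (if mu = 0 then 1 else 0)"
  have "egf (\<lambda>n. gamma_density (mu + real (Suc n)) y) x * egf (\<lambda>n. gamma_tail (mu + real n) y) x
    < egf (\<lambda>n. gamma_density (mu + real n) y) x * egf (\<lambda>n. gamma_tail (mu + real (Suc n)) y) x"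
  proof (rule egf_Suc_mult_less[where i = i and j = "Suc i"])
    show "gamma_density (mu + real (Suc i)) y * gamma_tail (mu + real i) y
        < gamma_density (mu + real i) y * gamma_tail (mu + real (Suc i)) y"
      using mu by (intro less) (auto simp: i_def)
    show "x = 0 \<Longrightarrow> i = 0 \<and> Suc i = 1"
      using assms by (auto simp: i_def admissible_def)
  qed (use mu assms le in \<open>auto intro!: gamma_tail_bounded gamma_density_bounded\<close>)
  then show ?thesis by (simp add: add_ac)
qed

section \<open>Lower bounds and monotonicity of H\<close>

lemma Hfun_gt_cfun:
  assumes "admissible mu x" "0 < y"
  shows "cfun mu x y < Hfun mu x y"
  using egf_gamma_density_tail_less[OF assms] egf_gamma_density_pos[OF assms]
    egf_gamma_tail_pos[OF assms]
  by (simp add: cfun_eq_egf Hfun_eq_egf assms divide_simps mult_ac)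

lemma Hfun_gt_1:
  assumes "admissible mu x" "0 < y"
  shows "1 < Hfun mu x y"
proof -
  have mu: "0 \<le> mu" using assms by (auto simp: admissible_def)
  have adm: "admissible (mu + 1) x" using assms(1) by (auto simp: admissible_def)
  have "gamma_tail (mu + 1 + real n) y
      = gamma_tail (mu + real n) y + gamma_density (mu + 1 + real n) y" for n
    using gamma_tail_add_1[of "mu + real n" y] mu assms by (simp add: add_ac)
  then have "egf (\<lambda>n. gamma_tail (mu + 1 + real n) y) x = egf (\<lambda>n. gamma_tail (mu + real n) y) x
      + egf (\<lambda>n. gamma_density (mu + 1 + real n) y) x"
    using egf_add[of "\<lambda>n. gamma_tail (mu + real n) y", OF gamma_tail_bounded gamma_density_bounded]
      mu assms by simp
  then show ?thesis
    using egf_gamma_density_pos[OF adm assms(2)] egf_gamma_tail_pos[OF assms]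
    by (simp add: Hfun_eq_egf assms)
qed

lemma Hfun_strict_antimono_order:
  assumes "admissible nu x" "nu < mu" "0 < y"
  shows "Hfun mu x y < Hfun nu x y"
proof -
  have adm: "admissible mu x" using assms by (auto simp: admissible_def)
  show ?thesis
    using egf_gamma_tail_log_concave[OF assms] egf_gamma_tail_pos[OF adm assms(3)]
      egf_gamma_tail_pos[OF assms(1,3)]
    by (simp add: Hfun_eq_egf adm assms divide_simps mult_ac)
qed

lemma Hfun_strict_mono_y:
  assumes "admissible mu x" "0 < y1" "y1 < y2"
  shows "Hfun mu x y1 < Hfun mu x y2"
proof -
  let ?Q = "\<lambda>mu y. egf (\<lambda>n. gamma_tail (mu + real n) y) x"
  let ?f = "\<lambda>mu y. egf (\<lambda>n. gamma_density (mu + real n) y) x"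
  have mu: "0 \<le> mu" "0 \<le> x" using assms by (auto simp: admissible_def)
  have "?Q (mu + 1) y1 / ?Q mu y1 < ?Q (mu + 1) y2 / ?Q mu y2"
  proof (rule DERIV_pos_imp_increasing[OF assms(3)], intro exI conjI)
    fix y assume "y1 \<le> y" "y \<le> y2"
    with assms have y: "0 < y" by simp
    have pos: "0 < ?Q mu y" by (rule egf_gamma_tail_pos[OF assms(1) y])
    show "((\<lambda>y. ?Q (mu + 1) y / ?Q mu y) has_real_derivative
        (- ?f (mu + 1) y * ?Q mu y - ?Q (mu + 1) y * - ?f mu y) / (?Q mu y * ?Q mu y)) (at y)"
      using mu y pos by (intro DERIV_divide DERIV_egf_gamma_tail) auto
    \<comment> \<open>The numerator is
      \<open>?f mu y * ?Q (mu + 1) y - ?f (mu + 1) y * ?Q mu y\<close>, so its positivity is the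
      inequality behind \<open>H > c\<close>.\<close>
    show "0 < (- ?f (mu + 1) y * ?Q mu y - ?Q (mu + 1) y * - ?f mu y) / (?Q mu y * ?Q mu y)"
      using egf_gamma_density_tail_less[OF assms(1) y] pos
      by (intro divide_pos_pos) (auto simp: mult_ac)
  qed
  with assms show ?thesis by (simp add: Hfun_eq_egf)
qed

text \<open>Shifting \<open>mu\<close> by one is differentiation in \<open>x\<close>, so log-concavity in \<open>mu\<close> yields that in
  \<open>x\<close>.\<close>
lemma Hfun_strict_antimono_x:
  assumes "admissible mu x1" "x1 < x2" "0 < y"
  shows "Hfun mu x2 y < Hfun mu x1 y"
proof -
  let ?Q = "\<lambda>mu x. egf (\<lambda>n. gamma_tail (mu + real n) y) x"
  have mu: "0 \<le> mu" using assms by (auto simp: admissible_def)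
  have adm: "admissible mu x" if "x1 \<le> x" for x
    using assms(1) that by (auto simp: admissible_def)
  have DQ: "(?Q nu has_real_derivative ?Q (nu + 1) x) (at x)" if "0 \<le> nu" for nu x
    using DERIV_egf[of "\<lambda>n. gamma_tail (nu + real n) y" 1 x] gamma_tail_bounded[of nu y] assms that
    by (simp add: add_ac)
  have "?Q (mu + 1) x2 / ?Q mu x2 < ?Q (mu + 1) x1 / ?Q mu x1"
  proof (rule DERIV_neg_imp_decreasing[OF assms(2)], intro exI conjI)
    fix x assume "x1 \<le> x" "x \<le> x2"
    have pos: "0 < ?Q mu x" by (rule egf_gamma_tail_pos[OF adm[OF \<open>x1 \<le> x\<close>] assms(3)])
    show "((\<lambda>x. ?Q (mu + 1) x / ?Q mu x) has_real_derivative
        (?Q (mu + 1 + 1) x * ?Q mu x - ?Q (mu + 1) x * ?Q (mu + 1) x) / (?Q mu x * ?Q mu x)) (at x)"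
      using mu pos by (intro DERIV_divide DQ) auto
    show "(?Q (mu + 1 + 1) x * ?Q mu x - ?Q (mu + 1) x * ?Q (mu + 1) x) / (?Q mu x * ?Q mu x) < 0"
      using egf_gamma_tail_log_concave[OF adm[OF \<open>x1 \<le> x\<close>], of "mu + 1" y] assms(3) pos
      by (intro divide_neg_pos) (auto simp: mult_ac)
  qed
  with assms adm[of x2] show ?thesis by (simp add: Hfun_eq_egf)
qed

theorem theorem6:
  shows "(\<forall>mu x y1 y2. admissible mu x \<and> 0 < y1 \<and> y1 < y2 \<longrightarrow> Hfun mu x y1 < Hfun mu x y2)
    \<and> (\<forall>mu x1 x2 y. admissible mu x1 \<and> admissible mu x2 \<and> x1 < x2 \<and> 0 < y
          \<longrightarrow> Hfun mu x2 y < Hfun mu x1 y)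
    \<and> (\<forall>mu1 mu2 x y. admissible mu1 x \<and> admissible mu2 x \<and> mu1 < mu2 \<and> 0 < y
          \<longrightarrow> Hfun mu2 x y < Hfun mu1 x y)
    \<and> (\<forall>mu x y. admissible mu x \<and> 0 < y \<longrightarrow> Hfun mu x y > max 1 (cfun mu x y))"
  using Hfun_strict_mono_y Hfun_strict_antimono_x Hfun_strict_antimono_order
    Hfun_gt_1 Hfun_gt_cfun
  by simp

end
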